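(* Let $N = AB$, where $A, B > 1$ are coprime natural numbers. Let $f$ be a polynomial with integer coefficients, let $n_0$ be a natural number, and let $(N_k) = (n_k)_{k\ge 0}$ be the infinite sequence generated by the rule $n_{i+1} = f(n_i) \bmod N$ for all $i \ge 0$. Let $(A_k)$ and $(B_k)$ be the sequences obtained by reducing each $n_k$ modulo $A$ and modulo $B$, respectively. Let $\lambda$, $\lambda_A$, $\lambda_B$ be the lengths of the cycles of $(N_k)$, $(A_k)$, $(B_k)$, respectively. Then $\lambda_A \ne \lambda_B$ if and only if there exists a natural number $m < \lambda$ such that $m$ is a multiple of $\lambda_A$ but not a multiple of $\lambda_B$, or $m$ is a multiple of $\lambda_B$ but not a multiple of $\lambda_A$. Moreover, for every such $m$, $$1 < \gcd(f^m(x) - x, N) < N$$ for some element $x$ inside the cycle of $(N_k)$.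
   Context: For an integer $a$ and a positive integer $M$, $a \bmod M$ denotes the remainder of $a$ in $\{0,1,\dots,M-1\}$. Each of the sequences $(N_k)$, $(A_k)$, $(B_k)$ is eventually periodic. The length of the cycle of an eventually periodic sequence $(s_k)_{k\ge 0}$ is the least integer $\lambda \ge 1$ for which there is $\mu \ge 0$ with $s_{k+\lambda} = s_k$ for all $k \ge \mu$. An element $x$ is inside the cycle of $(N_k)$ if $x = n_k$ for infinitely many indices $k$. The notation $f^m(x)$ means the $m$-th iterate of the map $y \mapsto f(y) \bmod N$ applied to $x$ (so $f^0(x) = x$ and, if $x = n_k$, then $f^m(x) = n_{k+m}$). *)

theory Defs
  imports "HOL-Computational_Algebra.Polynomial"
begin

definition poly_step :: "int poly \<Rightarrow> nat \<Rightarrow> int \<Rightarrow> int" where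
  "poly_step f N y = poly f y mod int N"

primrec poly_seq :: "int poly \<Rightarrow> nat \<Rightarrow> nat \<Rightarrow> nat \<Rightarrow> int" where
  "poly_seq f N n0 0 = int n0"  (* the starting value is not reduced modulo N *)
| "poly_seq f N n0 (Suc i) = poly f (poly_seq f N n0 i) mod int N"

(* Meaningful only for eventually periodic s, where the set of such l is nonempty. *)
definition cycle_length :: "(nat \<Rightarrow> 'a) \<Rightarrow> nat" where
  "cycle_length s = (LEAST l. 1 \<le> l \<and> (\<exists>mu. \<forall>k\<ge>mu. s (k + l) = s k))"

definition inside_cycle :: "(nat \<Rightarrow> 'a) \<Rightarrow> 'a \<Rightarrow> bool" where
  "inside_cycle s x \<longleftrightarrow> infinite {k. s k = x}"

end

theory Submission
  imports Defs
begin

text \<open>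
  The eventual periods of an eventually periodic sequence are exactly the multiples of its cycle
  length. Hence a multiple \<open>m\<close> of one cycle length that is not a multiple of the other is an
  eventual period of one residue sequence, while in the other one terms at distance \<open>m\<close> differ
  infinitely often. Far enough along the cycle this yields a difference of terms that is divisible
  by exactly one of the two coprime factors. If the cycle lengths differ, the smaller of them is
  such an \<open>m\<close>.
\<close>

definition eventual_period :: "(nat \<Rightarrow> 'a) \<Rightarrow> nat \<Rightarrow> bool" where
  "eventual_period s l \<longleftrightarrow> (\<forall>\<^sub>F k in sequentially. s (k + l) = s k)"

lemma cycle_length_eq: "cycle_length s = (LEAST l. 1 \<le> l \<and> eventual_period s l)"
  by (simp add: cycle_length_def eventual_period_def eventually_sequentially)

text \<open>For large \<open>k\<close> the index \<open>k + j\<close> also lies in the periodic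
  range, so a shift by \<open>j + l\<close> has the same effect as a shift by \<open>j\<close>. The
  equivalence allows periods to be subtracted as well as added, as reduction modulo the cycle length
  requires.\<close>

lemma eventual_period_add_iff:
  assumes "eventual_period s l"
  shows "eventual_period s (j + l) \<longleftrightarrow> eventual_period s j"
proof -
  have "\<forall>\<^sub>F k in sequentially. s ((k + j) + l) = s (k + j)"
    using assms unfolding eventual_period_def
    by (rule eventually_compose_filterlim) (rule filterlim_add_const_nat_at_top)
  then have "\<forall>\<^sub>F k in sequentially. s (k + (j + l)) = s k \<longleftrightarrow> s (k + j) = s k"
    by eventually_elim (simp add: add.assoc)
  then show ?thesis
    unfolding eventual_period_def by (rule eventually_cong)
qed

lemma eventual_period_add_mult_iff:
  assumes "eventual_period s l"
  shows "eventual_period s (j + q * l) \<longleftrightarrow> eventual_period s j"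
proof (induction q)
  case (Suc q)
  then show ?case
    using eventual_period_add_iff[OF assms, of "j + q * l"] by (simp add: ac_simps)
qed simp

lemma
  assumes "eventual_period s l" "1 \<le> l"
  shows cycle_length_pos: "1 \<le> cycle_length s"
    and cycle_length_le: "cycle_length s \<le> l"
    and eventual_period_cycle_length: "eventual_period s (cycle_length s)"
proof -
  show "1 \<le> cycle_length s" "eventual_period s (cycle_length s)"
    using LeastI[of "\<lambda>l. 1 \<le> l \<and> eventual_period s l" l] assms
    by (simp_all add: cycle_length_eq)
  show "cycle_length s \<le> l"
    using assms by (simp add: cycle_length_eq Least_le)
qed

text \<open>Division with remainder: removing multiples of the cycle length from \<open>m\<close>
  leaves \<open>m mod ?c\<close>, which is below the least positive eventual period and so is an
  eventual period only if it is 0.\<close>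

lemma eventual_period_iff_cycle_length_dvd:
  assumes "eventual_period s l" "1 \<le> l"
  shows "eventual_period s m \<longleftrightarrow> cycle_length s dvd m"
proof -
  let ?c = "cycle_length s"
  have c: "1 \<le> ?c" "eventual_period s ?c"
    using assms by (rule cycle_length_pos, rule eventual_period_cycle_length)
  have "eventual_period s m \<longleftrightarrow> eventual_period s (m mod ?c)"
    using eventual_period_add_mult_iff[OF c(2), of "m mod ?c" "m div ?c"] by simp
  also have "\<dots> \<longleftrightarrow> m mod ?c = 0"
  proof
    assume per: "eventual_period s (m mod ?c)"
    show "m mod ?c = 0"
    proof (rule ccontr)
      assume "m mod ?c \<noteq> 0"
      then have "?c \<le> m mod ?c"
        using cycle_length_le[OF per] by simp
      moreover have "m mod ?c < ?c"
        using c(1) by simp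
      ultimately show False
        by simp
    qed
  qed (simp add: eventual_period_def)
  finally show ?thesis
    by (simp add: dvd_eq_mod_eq_0)
qed

text \<open>Every eventual period of \<open>s\<close> is inherited by its image under
  \<open>g\<close>. With \<open>g\<close> a reduction modulo a factor, this bounds
  \<open>lamA\<close> and \<open>lamB\<close> by \<open>lam\<close>.\<close>

lemma cycle_length_comp_le:
  assumes "eventual_period s l" "1 \<le> l"
  shows "cycle_length (\<lambda>k. g (s k)) \<le> cycle_length s"
proof -
  have "eventual_period s (cycle_length s)"
    using assms by (rule eventual_period_cycle_length)
  then have "eventual_period (\<lambda>k. g (s k)) (cycle_length s)"
    unfolding eventual_period_def by eventually_elim simp
  then show ?thesis
    using cycle_length_le cycle_length_pos[OF assms] by blast
qed

text \<open>Past the preperiod, the term at \<open>k\<close> recurs at each of the infinitely many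
  indices \<open>k + q * l\<close>.\<close>

lemma eventually_inside_cycle:
  assumes "eventual_period s l" "1 \<le> l"
  shows "\<forall>\<^sub>F k in sequentially. inside_cycle s (s k)"
proof -
  obtain mu where mu: "\<And>k. k \<ge> mu \<Longrightarrow> s (k + l) = s k"
    using assms(1) by (auto simp: eventual_period_def eventually_sequentially)
  have "inside_cycle s (s k)" if "k \<ge> mu" for k
  proof -
    have "s (k + q * l) = s k" for q
    proof (induction q)
      case (Suc q)
      then show ?case
        using mu[of "k + q * l"] that by (simp add: ac_simps)
    qed simp
    then have "range (\<lambda>q. k + q * l) \<subseteq> {j. s j = s k}"
      by auto
    moreover have "infinite (range (\<lambda>q. k + q * l))"
      using assms(2) by (intro range_inj_infinite injI) simp
    ultimately show ?thesis
      unfolding inside_cycle_def using finite_subset by blast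
  qed
  then show ?thesis
    by (auto simp: eventually_sequentially)
qed

lemma poly_step_funpow_poly_seq:
  "(poly_step f N ^^ m) (poly_seq f N n0 k) = poly_seq f N n0 (k + m)"
  by (induction m) (simp_all add: poly_step_def)

lemma poly_seq_eventually_periodic:
  assumes "N > 0"
  obtains l where "1 \<le> l" "eventual_period (poly_seq f N n0) l"
proof -
  let ?n = "poly_seq f N n0"
  \<comment> \<open>Pigeonhole on the residues modulo \<open>N\<close>. The index starts at 1
    because the initial value is not reduced and may lie outside this range.\<close>
  have "range (\<lambda>k. ?n (Suc k)) \<subseteq> {0..<int N}"
    using assms by auto
  then have "finite (range (\<lambda>k. ?n (Suc k)))"
    by (rule finite_subset) simp
  then have "\<not> inj (\<lambda>k. ?n (Suc k))"
    using range_inj_infinite by blast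
  then obtain i j where ij: "i < j" "?n (Suc i) = ?n (Suc j)"
    by (metis injI linorder_neqE_nat)
  have "?n (k + (j - i)) = ?n k" if "k \<ge> Suc i" for k
  proof -
    \<comment> \<open>Equal terms have equal futures: both sides arise by iterating the same map
      \<open>k - Suc i\<close> times.\<close>
    have "?n (k + (j - i)) = (poly_step f N ^^ (k - Suc i)) (?n (Suc j))"
      unfolding poly_step_funpow_poly_seq using that ij(1)
      by (intro arg_cong[where f = ?n]) simp
    also have "\<dots> = ?n k"
      unfolding ij(2)[symmetric] poly_step_funpow_poly_seq using that
      by (intro arg_cong[where f = ?n]) simp
    finally show ?thesis .
  qed
  then have "eventual_period ?n (j - i)"
    by (auto simp: eventual_period_def eventually_sequentially)
  with ij show thesis
    by (intro that[of "j - i"]) auto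
qed

text \<open>The gcd is a positive multiple of \<open>A\<close>, hence exceeds 1; if it were the
  whole product, \<open>B\<close> would divide \<open>d\<close>.\<close>

lemma proper_gcd_mult:
  fixes d :: int and A B :: nat
  assumes "A > 1" "B > 0" "int A dvd d" "\<not> int B dvd d"
  shows "1 < gcd d (int (A * B)) \<and> gcd d (int (A * B)) < int (A * B)"
proof
  let ?g = "gcd d (int (A * B))"
  have pos: "?g > 0" "int (A * B) > 0"
    using assms by auto
  have "int A \<le> ?g"
    using assms(3) pos by (intro zdvd_imp_le) auto
  then show "1 < ?g"
    using assms(1) by simp
  have "?g \<noteq> int (A * B)"
    using assms(4) by (metis dvd_mult_right gcd_dvd1 of_nat_mult)
  moreover have "?g \<le> int (A * B)"
    using pos(2) by (intro zdvd_imp_le) auto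
  ultimately show "?g < int (A * B)"
    by simp
qed

lemma inside_cycle_proper_gcd:
  fixes f :: "int poly" and A B n0 :: nat
  defines "n \<equiv> poly_seq f (A * B) n0"
  assumes "A > 1" "B > 0"
    and A: "eventual_period (\<lambda>k. n k mod int A) m"
    and B: "\<not> eventual_period (\<lambda>k. n k mod int B) m"
  shows "\<exists>x. inside_cycle n x \<and>
           1 < gcd ((poly_step f (A * B) ^^ m) x - x) (int (A * B)) \<and>
           gcd ((poly_step f (A * B) ^^ m) x - x) (int (A * B)) < int (A * B)"
proof -
  obtain l where "1 \<le> l" "eventual_period n l"
    unfolding n_def using poly_seq_eventually_periodic[of "A * B"] assms by auto
  then have "\<forall>\<^sub>F k in sequentially. inside_cycle n (n k)"
    by (intro eventually_inside_cycle)
  \<comment> \<open>Failing to be an eventual period means disagreement at infinitely many indices,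
    so one of them lies beyond the thresholds of the two eventual properties.\<close>
  moreover have "\<exists>\<^sub>F k in sequentially. n (k + m) mod int B \<noteq> n k mod int B"
    using B by (simp add: eventual_period_def not_eventually)
  ultimately have "\<exists>\<^sub>F k in sequentially. (inside_cycle n (n k) \<and>
      n (k + m) mod int A = n k mod int A) \<and> n (k + m) mod int B \<noteq> n k mod int B"
    using A unfolding eventual_period_def
    by (intro frequently_eventually_conj eventually_conj)
  then obtain k where k: "inside_cycle n (n k)"
      "int A dvd n (k + m) - n k" "\<not> int B dvd n (k + m) - n k"
    by (auto simp: mod_eq_dvd_iff dest!: frequently_ex)
  have "(poly_step f (A * B) ^^ m) (n k) = n (k + m)"
    by (simp add: n_def poly_step_funpow_poly_seq)
  then show ?thesis
    using k proper_gcd_mult[OF assms(2,3) k(2,3)] by (intro exI[of _ "n k"]) simp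
qed

theorem theorem4:
  fixes A B N n0 :: nat and f :: "int poly"
    and n a b :: "nat \<Rightarrow> int" and lam lamA lamB :: nat
  assumes "A > 1" and "B > 1" and "coprime A B" and "N = A * B"
    and "n = poly_seq f N n0"
    and "a = (\<lambda>k. n k mod int A)"
    and "b = (\<lambda>k. n k mod int B)"
    and "lam = cycle_length n"
    and "lamA = cycle_length a"
    and "lamB = cycle_length b"
  shows "(lamA \<noteq> lamB \<longleftrightarrow>
            (\<exists>m<lam. (lamA dvd m \<and> \<not> lamB dvd m) \<or> (lamB dvd m \<and> \<not> lamA dvd m)))
       \<and> (\<forall>m<lam. (lamA dvd m \<and> \<not> lamB dvd m) \<or> (lamB dvd m \<and> \<not> lamA dvd m) \<longrightarrow>
            (\<exists>x. inside_cycle n x \<and>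
                 1 < gcd ((poly_step f N ^^ m) x - x) (int N) \<and>
                 gcd ((poly_step f N ^^ m) x - x) (int N) < int N))"
proof -
  \<comment> \<open>Both orders of the product are recorded because the gcd lemma is asymmetric in
    the factors and is also applied with \<open>A\<close> and \<open>B\<close> exchanged.\<close>
  have n: "n = poly_seq f (A * B) n0" "n = poly_seq f (B * A) n0" and N: "N = B * A"
    using assms by (simp_all add: mult.commute)
  obtain l where l: "1 \<le> l" "eventual_period n l"
    unfolding n(1) using poly_seq_eventually_periodic[of "A * B"] assms by auto
  have mod_per: "eventual_period (\<lambda>k. n k mod int M) l" for M
    using l(2) unfolding eventual_period_def by eventually_elim simp
  have dvd_A: "lamA dvd m \<longleftrightarrow> eventual_period a m" for m
    using eventual_period_iff_cycle_length_dvd[OF mod_per l(1)] assms by simp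
  have dvd_B: "lamB dvd m \<longleftrightarrow> eventual_period b m" for m
    using eventual_period_iff_cycle_length_dvd[OF mod_per l(1)] assms by simp
  have pos: "lamA > 0" "lamB > 0"
    using cycle_length_pos[OF mod_per l(1), of A] cycle_length_pos[OF mod_per l(1), of B] assms
    by simp_all
  have le: "lamA \<le> lam" "lamB \<le> lam"
    using cycle_length_comp_le[OF l(2,1)] assms by simp_all
  have "\<exists>m<lam. (lamA dvd m \<and> \<not> lamB dvd m) \<or> (lamB dvd m \<and> \<not> lamA dvd m)"
    if "lamA \<noteq> lamB"
  \<comment> \<open>The witness is the smaller cycle length: it divides itself, the larger one
    cannot divide it since it is positive, and it lies strictly below the larger one, hence below
    \<open>lam\<close>.\<close>
  proof (cases "lamA < lamB")
    case True
    then show ?thesis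
      using pos le by (intro exI[of _ lamA]) (auto dest: dvd_imp_le)
  next
    case False
    then show ?thesis
      using that pos le by (intro exI[of _ lamB]) (auto dest: dvd_imp_le)
  qed
  moreover have "\<exists>x. inside_cycle n x \<and>
      1 < gcd ((poly_step f N ^^ m) x - x) (int N) \<and>
      gcd ((poly_step f N ^^ m) x - x) (int N) < int N"
    if m: "(lamA dvd m \<and> \<not> lamB dvd m) \<or> (lamB dvd m \<and> \<not> lamA dvd m)" for m
    using m
  proof
    assume "lamA dvd m \<and> \<not> lamB dvd m"
    then show ?thesis
      using inside_cycle_proper_gcd[where A = A and B = B and f = f and ?n0.0 = n0 and m = m, folded n(1)] assms(1,2,4,6,7)
      by (simp add: dvd_A dvd_B)
  next
    assume "lamB dvd m \<and> \<not> lamA dvd m"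
    then show ?thesis
      using inside_cycle_proper_gcd[where A = B and B = A and f = f and ?n0.0 = n0 and m = m, folded n(2) N] assms(1,2,6,7)
      by (simp add: dvd_A dvd_B)
  qed
  ultimately show ?thesis
    by blast
qed

end
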